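(* If the neighbor graph $\mathbb{G}$ is strongly connected, and $b_i\in(0,1)$ for all $i\in\mathcal{V}$, then the equilibrium $x_e^\ast=[\mathbf{0}_{n_1}^\top,\mathbf{1}_{n_2}^\top]^\top$, $n_1+n_2=N$, of the system $x(k+1)=F(x(k))$ is unstable for every $n_1=1,\dots,N-1$.
   Context: There are $N$ agents, $\mathcal{V}=\{1,\dots,N\}$. $\mathbb{G}=(\mathcal{V},\mathcal{E})$ is a directed graph without self-loops, and $\mathcal{N}_i=\{j\in\mathcal{V}:(j,i)\in\mathcal{E}\}$ is the set of neighbors of agent $i$ (so $i\notin\mathcal{N}_i$). The graph is associated with a weight matrix $W=(w_{ij})_{N\times N}$ with self-weights $w_{ii}\ge 0$ for all $i$ and $w_{ij}>0$ whenever $(j,i)\in\mathcal{E}$. $\mathbb{G}$ is strongly connected if there is a directed path from every node to every other node. Each agent $i$ has a real bias parameter $b_i$. Put $d_i=\sum_{j\in\mathcal{N}_i}w_{ij}$ and, for $x=(x_1,\dots,x_N)^\top$, $s_i=\sum_{j\in\mathcal{N}_i}w_{ij}x_j$ and $$f_i(x)=\frac{w_{ii}x_i+x_i^{b_i}s_i}{w_{ii}+x_i^{b_i}s_i+(1-x_i)^{b_i}(d_i-s_i)},\qquad F(x)=[f_1(x),\dots,f_N(x)]^\top.$$ The opinion dynamics is $x(k+1)=F(x(k))$, $k=0,1,2,\dots$, with $x_i(0)\in[0,1]$ for all $i$. $\mathbf{0}_n$ and $\mathbf{1}_n$ are the $n$-dimensional all-zero and all-one vectors. For $b_i>0$, any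 vector with all entries either $0$ or $1$ is an equilibrium of the system; without loss of generality (labeling of the agents) such an equilibrium is written $x_e^\ast=[\mathbf{0}_{n_1}^\top,\mathbf{1}_{n_2}^\top]^\top$ with $n_1+n_2=N$, i.e. its first $n_1$ entries are $0$ and its last $n_2$ entries are $1$. Instability is in the usual sense for equilibria of discrete-time systems. *)

theory Defs
  imports
    "HOL-Analysis.Analysis"
    "Graph_Theory.Digraph_Component"
    "Graph_Theory.Pair_Digraph"
begin

text \<open>An arc \<open>(j, i)\<close> points from \<open>j\<close> to \<open>i\<close>; the neighbors of \<open>i\<close> are its in-neighbors.\<close>

definition neighbors :: "'n pair_pre_digraph \<Rightarrow> 'n \<Rightarrow> 'n set" where
  "neighbors G i = {j \<in> pverts G. (j, i) \<in> parcs G}"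

definition wdeg :: "'n::finite pair_pre_digraph \<Rightarrow> real^'n^'n \<Rightarrow> 'n \<Rightarrow> real" where
  "wdeg G W i = (\<Sum>j\<in>neighbors G i. W $ i $ j)"

definition wsum :: "'n::finite pair_pre_digraph \<Rightarrow> real^'n^'n \<Rightarrow> real^'n \<Rightarrow> 'n \<Rightarrow> real" where
  "wsum G W x i = (\<Sum>j\<in>neighbors G i. W $ i $ j * x $ j)"

definition opinion_num ::
  "'n::finite pair_pre_digraph \<Rightarrow> real^'n^'n \<Rightarrow> ('n \<Rightarrow> real) \<Rightarrow> real^'n \<Rightarrow> 'n \<Rightarrow> real" where
  "opinion_num G W b x i = W $ i $ i * x $ i + (x $ i) powr (b i) * wsum G W x i"

definition opinion_den ::
  "'n::finite pair_pre_digraph \<Rightarrow> real^'n^'n \<Rightarrow> ('n \<Rightarrow> real) \<Rightarrow> real^'n \<Rightarrow> 'n \<Rightarrow> real" where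
  "opinion_den G W b x i =
     W $ i $ i + (x $ i) powr (b i) * wsum G W x i
       + (1 - x $ i) powr (b i) * (wdeg G W i - wsum G W x i)"

text \<open>
  For states in the unit cube, positive arc weights and a nonempty neighborhood of \<open>i\<close>, the
  denominator vanishes only if \<open>W $ i $ i = 0\<close> and either \<open>x $ i = 0\<close> with all neighbors at \<open>1\<close>,
  or \<open>x $ i = 1\<close> with all neighbors at \<open>0\<close>. In this \<open>0 / 0\<close> case the agent keeps its opinion, so
  that every vector with entries in \<open>{0, 1}\<close> is an equilibrium, also with zero self-weights.
  (The library value \<open>0 / 0 = 0\<close> would break this for \<open>x $ i = 1\<close>.)
\<close>

definition opinion_map ::
  "'n::finite pair_pre_digraph \<Rightarrow> real^'n^'n \<Rightarrow> ('n \<Rightarrow> real) \<Rightarrow> real^'n \<Rightarrow> real^'n" where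
  "opinion_map G W b x =
     (\<chi> i. if opinion_den G W b x i = 0 then x $ i
           else opinion_num G W b x i / opinion_den G W b x i)"

definition unit_cube :: "(real^'n) set" where
  "unit_cube = {x. \<forall>i. 0 \<le> x $ i \<and> x $ i \<le> 1}"

text \<open>
  Notions for the system \<open>x(k+1) = F (x(k))\<close> with state space \<open>X\<close>: perturbed initial states
  range over \<open>X\<close> only. Stability is in the sense of Lyapunov.
\<close>

definition equilibrium_on :: "'a set \<Rightarrow> ('a \<Rightarrow> 'a) \<Rightarrow> 'a \<Rightarrow> bool" where
  "equilibrium_on X F xe \<longleftrightarrow> xe \<in> X \<and> F xe = xe"

definition stable_on :: "'a::metric_space set \<Rightarrow> ('a \<Rightarrow> 'a) \<Rightarrow> 'a \<Rightarrow> bool" where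
  "stable_on X F xe \<longleftrightarrow>
     (\<forall>\<epsilon>>0. \<exists>\<delta>>0. \<forall>x0\<in>X. dist x0 xe < \<delta> \<longrightarrow> (\<forall>k. dist ((F ^^ k) x0) xe < \<epsilon>))"

definition unstable_equilibrium_on :: "'a::metric_space set \<Rightarrow> ('a \<Rightarrow> 'a) \<Rightarrow> 'a \<Rightarrow> bool" where
  "unstable_equilibrium_on X F xe \<longleftrightarrow> equilibrium_on X F xe \<and> \<not> stable_on X F xe"

text \<open>
  With agents numbered \<open>1, \<dots>, N\<close> by \<open>label\<close>, the vector whose first \<open>n1\<close> entries are \<open>0\<close> and
  whose remaining entries are \<open>1\<close>.
\<close>

definition polarized :: "('n \<Rightarrow> nat) \<Rightarrow> nat \<Rightarrow> real^'n" where
  "polarized label n1 = (\<chi> i. if label i \<le> n1 then 0 else 1)"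

end

theory Submission
  imports Defs
begin

text \<open>
  Both opinions occur in a polarized state, so strong connectivity yields an arc \<open>(j, i)\<close> from an
  agent \<open>j\<close> with opinion \<open>1\<close> to an agent \<open>i\<close> with opinion \<open>0\<close>. The polarized state is then
  repelling in the direction of \<open>x $ i\<close>. As long as \<open>x $ j \<ge> 1/2\<close>, the neighbor \<open>j\<close> alone contributes
  at least \<open>(x $ i) powr (b i) * W $ i $ j / 2\<close> to the numerator of \<open>f\<^sub>i\<close>, while the denominator never exceeds
  the constant \<open>W $ i $ i + wdeg G W i\<close>. Since \<open>b i < 1\<close>, the function \<open>t \<mapsto> t powr (b i)\<close> has
  infinite slope at \<open>0\<close>, so it beats every linear function there: near the equilibrium, one step
  at least doubles \<open>x $ i\<close> (lemma \<open>opinion_map_doubles\<close>). An orbit starting from the equilibrium with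
  only \<open>x $ i\<close> raised, however slightly, would therefore grow without bound if it stayed close
  (lemma \<open>not_stable_onI_doubling\<close>).
\<close>

section \<open>A criterion for instability\<close>

text \<open>
  The function \<open>h\<close> measures an unstable direction. If the state were stable, some orbit with
  \<open>h > 0\<close> initially would stay in the ball where \<open>h\<close> at least doubles at every step, and \<open>2 ^ k * h x0\<close>
  would exceed the bound \<open>B\<close>. Positivity of \<open>h x\<close> may be used for the doubling, because it is
  inherited along the orbit; at the equilibrium itself \<open>h\<close> typically vanishes.
\<close>

lemma not_stable_onI_doubling:
  fixes F :: "'a::metric_space \<Rightarrow> 'a" and h :: "'a \<Rightarrow> real"
  assumes invariant: "\<And>x. x \<in> X \<Longrightarrow> F x \<in> X"
    and "\<epsilon> > 0"
    and doubling: "\<And>x. x \<in> X \<Longrightarrow> dist x xe < \<epsilon> \<Longrightarrow> h x > 0 \<Longrightarrow> 2 * h x \<le> h (F x)"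
    and bounded: "\<And>x. x \<in> X \<Longrightarrow> h x \<le> B"
    and starts: "\<And>\<delta>. \<delta> > 0 \<Longrightarrow> \<exists>x0\<in>X. dist x0 xe < \<delta> \<and> h x0 > 0"
  shows "\<not> stable_on X F xe"
proof
  assume "stable_on X F xe"
  with \<open>\<epsilon> > 0\<close> obtain \<delta> where "\<delta> > 0"
    and close: "\<And>x0 k. x0 \<in> X \<Longrightarrow> dist x0 xe < \<delta> \<Longrightarrow> dist ((F ^^ k) x0) xe < \<epsilon>"
    unfolding stable_on_def by meson
  from starts[OF \<open>\<delta> > 0\<close>] obtain x0 where x0: "x0 \<in> X" "dist x0 xe < \<delta>" "h x0 > 0"
    by blast
  have orbit: "(F ^^ k) x0 \<in> X \<and> 2 ^ k * h x0 \<le> h ((F ^^ k) x0)" for k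
  proof (induction k)
    case 0
    show ?case using x0 by simp
  next
    case (Suc k)
    have "0 < 2 ^ k * h x0" using x0 by simp
    then have "2 * h ((F ^^ k) x0) \<le> h (F ((F ^^ k) x0))"
      using Suc close[OF x0(1,2), of k] by (intro doubling) auto
    then show ?case using Suc invariant by auto
  qed
  obtain k where "B / h x0 < 2 ^ k"
    using real_arch_pow[of 2] by auto
  then have "B < 2 ^ k * h x0"
    using x0(3) by (simp add: field_simps)
  with orbit[of k] bounded[of "(F ^^ k) x0"] show False
    by linarith
qed

section \<open>Arcs leaving a set of vertices\<close>

lemma strongly_connected_arc_leaving:
  assumes "strongly_connected (with_proj G)"
    and "u \<in> pverts G" "v \<in> pverts G" "u \<in> S" "v \<notin> S"
  obtains j i where "(j, i) \<in> parcs G" "j \<in> S" "i \<notin> S"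
proof -
  have "(u, v) \<in> rtrancl_on (pverts G) (parcs G)"
    using assms(1-3) unfolding strongly_connected_def reachable_def by auto
  then have "v \<in> S" if "\<And>j i. (j, i) \<in> parcs G \<Longrightarrow> j \<in> S \<Longrightarrow> i \<in> S"
    using \<open>u \<in> S\<close> by (induction rule: rtrancl_on.induct) (use that in auto)
  with \<open>v \<notin> S\<close> that show thesis by blast
qed

section \<open>Bounds on the opinion map\<close>

lemma wsum_bounds:
  assumes pos: "\<And>i j. (j, i) \<in> parcs G \<Longrightarrow> W $ i $ j > 0" and x: "x \<in> unit_cube"
  shows "0 \<le> wsum G W x i" "wsum G W x i \<le> wdeg G W i"
proof -
  have "0 \<le> W $ i $ j" if "j \<in> neighbors G i" for j
    using that pos[of j i] by (simp add: neighbors_def less_imp_le)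
  moreover have "0 \<le> x $ j \<and> x $ j \<le> 1" for j
    using x by (simp add: unit_cube_def)
  ultimately show "0 \<le> wsum G W x i" "wsum G W x i \<le> wdeg G W i"
    unfolding wsum_def wdeg_def
    by (auto intro!: sum_nonneg sum_mono mult_left_le)
qed

lemma opinion_num_bounds:
  assumes self: "\<And>i. W $ i $ i \<ge> 0"
    and pos: "\<And>i j. (j, i) \<in> parcs G \<Longrightarrow> W $ i $ j > 0" and x: "x \<in> unit_cube"
  shows "0 \<le> opinion_num G W b x i" "opinion_num G W b x i \<le> opinion_den G W b x i"
proof -
  have xi: "0 \<le> x $ i" "x $ i \<le> 1"
    using x by (auto simp: unit_cube_def)
  note s = wsum_bounds[of G W x i, OF pos x]
  show "0 \<le> opinion_num G W b x i"
    unfolding opinion_num_def using xi s self[of i] by simp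
  have "W $ i $ i * x $ i \<le> W $ i $ i"
    using xi self[of i] by (simp add: mult_left_le)
  moreover have "0 \<le> (1 - x $ i) powr b i * (wdeg G W i - wsum G W x i)"
    using s by simp
  ultimately show "opinion_num G W b x i \<le> opinion_den G W b x i"
    unfolding opinion_num_def opinion_den_def by linarith
qed

text \<open>Both powers are at most \<open>1\<close>, so the neighbors with weight \<open>wsum\<close> and those with the
  complementary weight together contribute at most \<open>wdeg\<close>.\<close>

lemma opinion_den_le:
  assumes pos: "\<And>i j. (j, i) \<in> parcs G \<Longrightarrow> W $ i $ j > 0" and x: "x \<in> unit_cube"
    and "b i \<ge> 0"
  shows "opinion_den G W b x i \<le> W $ i $ i + wdeg G W i"
proof -
  have xi: "0 \<le> x $ i" "x $ i \<le> 1"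
    using x by (auto simp: unit_cube_def)
  note s = wsum_bounds[of G W x i, OF pos x]
  have "(x $ i) powr b i * wsum G W x i \<le> 1 * wsum G W x i"
    using xi s \<open>b i \<ge> 0\<close> by (intro mult_right_mono powr_le1) auto
  moreover have "(1 - x $ i) powr b i * (wdeg G W i - wsum G W x i)
      \<le> 1 * (wdeg G W i - wsum G W x i)"
    using xi s \<open>b i \<ge> 0\<close> by (intro mult_right_mono powr_le1) auto
  ultimately have "(x $ i) powr b i * wsum G W x i
      + (1 - x $ i) powr b i * (wdeg G W i - wsum G W x i)
      \<le> 1 * wsum G W x i + 1 * (wdeg G W i - wsum G W x i)"
    by (rule add_mono)
  then show ?thesis
    by (simp add: opinion_den_def)
qed

lemma opinion_map_in_unit_cube:
  assumes self: "\<And>i. W $ i $ i \<ge> 0"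
    and pos: "\<And>i j. (j, i) \<in> parcs G \<Longrightarrow> W $ i $ j > 0" and x: "x \<in> unit_cube"
  shows "opinion_map G W b x \<in> unit_cube"
proof -
  have "0 \<le> opinion_map G W b x $ i \<and> opinion_map G W b x $ i \<le> 1" for i
  proof (cases "opinion_den G W b x i = 0")
    case True
    then show ?thesis using x by (simp add: opinion_map_def unit_cube_def)
  next
    case False
    with opinion_num_bounds[of W G x b i, OF self pos x] show ?thesis
      by (simp add: opinion_map_def)
  qed
  then show ?thesis by (simp add: unit_cube_def)
qed

lemma opinion_map_fixes_vertex:
  assumes "\<And>i. x $ i = 0 \<or> x $ i = 1"
  shows "opinion_map G W b x = x"
proof -
  have "opinion_map G W b x $ i = x $ i" for i
    using assms[of i] by (auto simp: opinion_map_def opinion_num_def opinion_den_def)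
  then show ?thesis by (simp add: vec_eq_iff)
qed

section \<open>Expansion along a disagreeing arc\<close>

text \<open>
  Since \<open>p < 1\<close>, the quotient \<open>c * t powr p / t = c / t powr (1 - p)\<close> tends to infinity as
  \<open>t\<close> tends to \<open>0\<close>; the threshold below is where it equals \<open>2\<close>.
\<close>

lemma powr_doubles_below_threshold:
  fixes c p t :: real
  assumes "c > 0" "p < 1" "0 < t" "t \<le> (c / 2) powr (1 / (1 - p))"
  shows "2 * t \<le> c * t powr p"
proof -
  have "t powr (1 - p) \<le> ((c / 2) powr (1 / (1 - p))) powr (1 - p)"
    using assms by (intro powr_mono2) auto
  also have "\<dots> = c / 2"
    using assms by (simp add: powr_powr)
  finally have "t powr (1 - p) * t powr p \<le> c / 2 * t powr p"
    by (intro mult_right_mono) auto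
  moreover have "t powr (1 - p) * t powr p = t"
    using assms by (simp flip: powr_add)
  ultimately show ?thesis by simp
qed

text \<open>
  Only the contribution of the single neighbor \<open>j\<close> is kept in the numerator. The numerator is
  then positive, hence so is the denominator, and the exceptional clause of \<open>opinion_map\<close> does not
  apply.
\<close>

lemma opinion_map_doubles:
  assumes self: "\<And>i. W $ i $ i \<ge> 0"
    and pos: "\<And>i j. (j, i) \<in> parcs G \<Longrightarrow> W $ i $ j > 0" and x: "x \<in> unit_cube"
    and b: "0 \<le> b i" "b i < 1"
    and j: "j \<in> neighbors G i" "1 / 2 \<le> x $ j"
    and xi: "0 < x $ i"
      "x $ i \<le> (W $ i $ j / (4 * (W $ i $ i + wdeg G W i))) powr (1 / (1 - b i))"
  shows "2 * x $ i \<le> opinion_map G W b x $ i"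
proof -
  define M where "M = W $ i $ i + wdeg G W i"
  define c where "c = W $ i $ j / (2 * M)"
  have w: "0 < W $ i $ k" if "k \<in> neighbors G i" for k
    using that pos[of k i] by (simp add: neighbors_def)
  have x0: "0 \<le> x $ k" for k
    using x by (simp add: unit_cube_def)
  have "W $ i $ j \<le> wdeg G W i"
    unfolding wdeg_def using j w by (intro member_le_sum) (auto simp: less_imp_le)
  then have "M > 0"
    unfolding M_def using self[of i] w[OF j(1)] by linarith
  have "c > 0"
    using w[OF j(1)] \<open>M > 0\<close> by (simp add: c_def)
  have "W $ i $ j * (1 / 2) \<le> W $ i $ j * x $ j"
    using w[OF j(1)] j(2) by (intro mult_left_mono) auto
  also have "\<dots> \<le> wsum G W x i"
    unfolding wsum_def using j w x0
    by (intro member_le_sum[of j _ "\<lambda>k. W $ i $ k * x $ k"]) (auto simp: less_imp_le)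
  finally have "(x $ i) powr b i * (W $ i $ j / 2) \<le> (x $ i) powr b i * wsum G W x i"
    by (intro mult_left_mono) auto
  also have "\<dots> \<le> opinion_num G W b x i"
    unfolding opinion_num_def using self[of i] x0[of i] by simp
  finally have num: "(x $ i) powr b i * (W $ i $ j / 2) \<le> opinion_num G W b x i" .
  have "0 < (x $ i) powr b i * (W $ i $ j / 2)"
    using xi w[OF j(1)] by simp
  then have den: "0 < opinion_den G W b x i" and "0 < opinion_num G W b x i"
    using num opinion_num_bounds(2)[of W G x b i, OF self pos x] by linarith+
  have "2 * x $ i \<le> c * (x $ i) powr b i"
    using \<open>c > 0\<close> b xi by (intro powr_doubles_below_threshold) (auto simp: c_def M_def)
  also have "\<dots> = (x $ i) powr b i * (W $ i $ j / 2) / M"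
    by (simp add: c_def)
  also have "\<dots> \<le> opinion_num G W b x i / M"
    using num \<open>M > 0\<close> by (intro divide_right_mono) auto
  also have "\<dots> \<le> opinion_num G W b x i / opinion_den G W b x i"
    using opinion_den_le[of G W x b i, OF pos x b(1)] den \<open>0 < opinion_num G W b x i\<close> \<open>M > 0\<close>
    by (intro divide_left_mono) (auto simp: M_def)
  also have "\<dots> = opinion_map G W b x $ i"
    using den by (simp add: opinion_map_def)
  finally show ?thesis .
qed

section \<open>Instability of polarized states\<close>

theorem theorem4:
  fixes G :: "'n::finite pair_pre_digraph"
    and W :: "real^'n^'n"
    and b :: "'n \<Rightarrow> real"
    and label :: "'n \<Rightarrow> nat"
    and n1 n2 :: nat
  assumes "pair_digraph G" and "pverts G = UNIV"
    and "strongly_connected (with_proj G)"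
    and "\<And>i. W $ i $ i \<ge> 0"
    and "\<And>i j. (j, i) \<in> parcs G \<Longrightarrow> W $ i $ j > 0"
    and "\<And>i. b i \<in> {0<..<1}"
    and "bij_betw label UNIV {1..CARD('n)}"
    and "n1 + n2 = CARD('n)" and "n1 \<in> {1..CARD('n) - 1}"
  shows "unstable_equilibrium_on unit_cube (opinion_map G W b) (polarized label n1)"
proof -
  note self = assms(4) and pos = assms(5)
  define xe :: "real^'n" where "xe = polarized label n1"
  have xe01: "xe $ i = 0 \<or> xe $ i = 1" for i
    by (simp add: xe_def polarized_def)
  have xe_cube: "xe \<in> unit_cube"
    unfolding unit_cube_def using xe01 by (smt (verit) mem_Collect_eq)

  have labels: "label ` UNIV = {1..CARD('n)}"
    using assms(7) by (simp add: bij_betw_def)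
  have "1 \<in> label ` UNIV" "CARD('n) \<in> label ` UNIV"
    unfolding labels using assms(9) by auto
  then obtain v u where "label v = 1" "label u = CARD('n)"
    by (metis imageE)
  then have "u \<in> {k. xe $ k = 1}" "v \<notin> {k. xe $ k = 1}"
    using assms(9) by (auto simp: xe_def polarized_def)
  then obtain j i where arc: "(j, i) \<in> parcs G" and "xe $ j = 1" and "xe $ i \<noteq> 1"
    using strongly_connected_arc_leaving[OF assms(3), of u v "{k. xe $ k = 1}"] assms(2) by auto
  then have "xe $ i = 0" using xe01 by blast
  have j: "j \<in> neighbors G i"
    using arc assms(2) by (simp add: neighbors_def)

  define r where "r = (W $ i $ j / (4 * (W $ i $ i + wdeg G W i))) powr (1 / (1 - b i))"
  have "0 < wdeg G W i"
    unfolding wdeg_def using j pos by (intro sum_pos) (auto simp: neighbors_def)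
  then have "r > 0"
    using pos[OF arc] self[of i] by (simp add: r_def)

  have "\<not> stable_on unit_cube (opinion_map G W b) xe"
  proof (rule not_stable_onI_doubling[where h = "\<lambda>x. x $ i" and \<epsilon> = "min (1 / 2) r" and B = 1])
    show "min (1 / 2) r > 0" using \<open>r > 0\<close> by simp
  next
    fix x :: "real^'n"
    assume x: "x \<in> unit_cube" "dist x xe < min (1 / 2) r" "0 < x $ i"
    have near: "\<bar>x $ k - xe $ k\<bar> < min (1 / 2) r" for k
      using dist_vec_nth_le[of x k xe] x(2) by (simp add: dist_real_def)
    have "1 / 2 \<le> x $ j" "x $ i \<le> r"
      using near[of j] near[of i] \<open>xe $ j = 1\<close> \<open>xe $ i = 0\<close> by linarith+
    then show "2 * x $ i \<le> opinion_map G W b x $ i"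
      using x assms(6)[of i] j
      by (intro opinion_map_doubles self pos) (auto simp: r_def)
  next
    fix \<delta> :: real
    assume "\<delta> > 0"
    define t where "t = min 1 (\<delta> / 2)"
    have t: "0 < t" "t \<le> 1" "t < \<delta>"
      using \<open>\<delta> > 0\<close> by (auto simp: t_def)
    define x0 where "x0 = xe + axis i t"
    have x0: "x0 $ k = (if k = i then t else xe $ k)" for k
      using \<open>xe $ i = 0\<close> by (simp add: x0_def axis_def)
    have "x0 \<in> unit_cube"
      using xe_cube t by (simp add: unit_cube_def x0)
    moreover have "dist x0 xe < \<delta>"
      using t by (simp add: x0_def dist_norm norm_eq_sqrt_inner inner_axis_axis real_sqrt_mult)
    ultimately show "\<exists>x0\<in>unit_cube. dist x0 xe < \<delta> \<and> 0 < x0 $ i"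
      using t by (intro bexI[of _ x0]) (auto simp: x0)
  qed (use opinion_map_in_unit_cube[OF self pos] in \<open>auto simp: unit_cube_def\<close>)
  then show ?thesis
    using opinion_map_fixes_vertex[OF xe01] xe_cube
    by (simp add: unstable_equilibrium_on_def equilibrium_on_def xe_def)
qed

end
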